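(* Let $\eta\in\mathbb{R}$ satisfy $\eta\ge\eta_0$, where $$\eta_0=-\left(\frac12+\frac{1}{\sinh 2}\right)\frac{1}{\cosh 1}\approx-0.502\cdots .$$ Let $p$ be a non-vanishing analytic function in $\mathbb{D}$ with $p(0)=1$ such that $$\eta\,p(z)+\frac{zp'(z)}{p(z)}\prec\eta\cosh\sqrt z+\frac{\sqrt z}{2}\tanh\sqrt z .$$ Then $p(z)\prec\cosh\sqrt z$, and $\cosh\sqrt z$ is the best dominant.
   Context: $\mathbb{D}=\{z\in\mathbb{C}:|z|<1\}$. For analytic functions $f,g$ on $\mathbb{D}$, $f\prec g$ means that $f(z)=g(w(z))$ for some analytic $w:\mathbb{D}\to\mathbb{D}$ with $w(0)=0$. The function $\cosh\sqrt z$ denotes the analytic function $\sum_{n=0}^\infty z^n/(2n)!$; the function $\sqrt z\tanh\sqrt z$ does not depend on the branch of the square root and is analytic in $\mathbb{D}$. A univalent function $q$ on $\mathbb{D}$ is a dominant of a differential subordination if $p\prec q$ for every $p$ satisfying it; a dominant $\tilde q$ is the best dominant if $\tilde q\prec q$ for every dominant $q$. *)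

theory Defs
  imports "HOL-Complex_Analysis.Complex_Analysis"
begin

abbreviation unit_disc :: "complex set" ("\<D>")
  where "\<D> \<equiv> ball 0 1"

definition subordinate :: "(complex \<Rightarrow> complex) \<Rightarrow> (complex \<Rightarrow> complex) \<Rightarrow> bool" (infix "\<prec>" 50)
  where "f \<prec> g \<longleftrightarrow> f holomorphic_on \<D> \<and> g holomorphic_on \<D> \<and>
    (\<exists>w. w holomorphic_on \<D> \<and> w ` \<D> \<subseteq> \<D> \<and> w 0 = 0 \<and> (\<forall>z\<in>\<D>. f z = g (w z)))"

definition univalent :: "(complex \<Rightarrow> complex) \<Rightarrow> bool"
  where "univalent q \<longleftrightarrow> q holomorphic_on \<D> \<and> inj_on q \<D>"

text \<open>A differential subordination enters the next two definitions through the set \<open>S\<close> of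
  the functions that satisfy it.\<close>

definition dominant :: "(complex \<Rightarrow> complex) set \<Rightarrow> (complex \<Rightarrow> complex) \<Rightarrow> bool"
  where "dominant S q \<longleftrightarrow> univalent q \<and> (\<forall>p\<in>S. p \<prec> q)"

definition best_dominant :: "(complex \<Rightarrow> complex) set \<Rightarrow> (complex \<Rightarrow> complex) \<Rightarrow> bool"
  where "best_dominant S q \<longleftrightarrow> dominant S q \<and> (\<forall>r. dominant S r \<longrightarrow> q \<prec> r)"

definition cosh_sqrt :: "complex \<Rightarrow> complex"
  where "cosh_sqrt z = (\<Sum>n. z ^ n / fact (2 * n))"

definition sqrt_tanh_sqrt :: "complex \<Rightarrow> complex"
  where "sqrt_tanh_sqrt z = csqrt z * tanh (csqrt z)"

text \<open>Both functions are independent of the branch of the square root.\<close>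

lemma cosh_sqrt_power2: "cosh_sqrt (s\<^sup>2) = cosh s"
proof -
  have "(\<lambda>n. if even n then s ^ n /\<^sub>R fact n else 0) sums cosh s"
    by (rule cosh_converges)
  then have "(\<lambda>n. (s\<^sup>2) ^ n / fact (2 * n)) sums cosh s"
    by (subst (asm) sums_mono_reindex [of "\<lambda>n. 2 * n", symmetric])
      (auto simp: strict_mono_def scaleR_conv_of_real field_simps simp flip: power_mult elim!: evenE)
  then show ?thesis
    by (simp add: cosh_sqrt_def sums_iff)
qed

lemma sqrt_tanh_sqrt_power2: "sqrt_tanh_sqrt (s\<^sup>2) = s * tanh s"
proof -
  have "csqrt (s\<^sup>2) = s \<or> csqrt (s\<^sup>2) = - s"
    by (metis power2_csqrt power2_eq_iff)
  then show ?thesis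
    by (auto simp: sqrt_tanh_sqrt_def)
qed

definition diff_subordination :: "real \<Rightarrow> (complex \<Rightarrow> complex) \<Rightarrow> bool"
  where "diff_subordination \<eta> p \<longleftrightarrow>
    (\<lambda>z. of_real \<eta> * p z + z * deriv p z / p z) \<prec>
    (\<lambda>z. of_real \<eta> * cosh_sqrt z + sqrt_tanh_sqrt z / 2)"

definition eta0 :: real
  where "eta0 = - (1 / 2 + 1 / sinh 2) * (1 / cosh 1)"

end

theory Submission
  imports Defs
begin

text \<open>Passing to logarithms, write \<open>p = exp P\<close> and \<open>cosh_sqrt = exp g\<close>, so that
  \<open>z g' = \<surd>z tanh \<surd>z / 2\<close> and the hypothesis reads
  \<open>\<eta> exp P + z P' \<prec> \<eta> exp g + z g'\<close>. The point is that \<open>g\<close> is a convex map: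
  \<open>1 + z g'' / g' = 1/2 + \<surd>z / sinh (2\<surd>z)\<close> has real part at least \<open>1/2 + 1 / sinh 2\<close>,
  which together with \<open>0 < Re (cosh_sqrt z) < cosh 1\<close> and \<open>\<eta> \<ge> eta0\<close> gives
  \<open>Re (\<eta> cosh_sqrt z + 1 + z g'' / g') > 0\<close>.

  Put \<open>P = g \<circ> \<omega>\<close> near \<open>0\<close>. If \<open>|\<omega> z| \<le> |z|\<close> failed, Jack's lemma would give a point
  \<open>x\<close> and \<open>m \<ge> 1\<close> with \<open>x P' x = m N\<close>, where \<open>N = \<omega> x * g' (\<omega> x)\<close> is the outward normal at
  \<open>g (\<omega> x)\<close> of the convex image of the disc of radius \<open>|\<omega> x|\<close>. The subordination, read in the
  coordinate \<open>u = g z\<close>, then says \<open>H u + (m - 1) N = H v\<close> for an interior point \<open>v\<close> of that image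
  and a function \<open>H\<close> with \<open>Re H' > 0\<close>. Integrating \<open>H'\<close> from \<open>u\<close> to \<open>v\<close> forces
  \<open>N \<bullet> (v - u) \<ge> 0\<close>, against convexity.\<close>

section \<open>Boundary growth, difference quotients and logarithms of analytic functions\<close>

lemma jack:
  fixes f :: "complex \<Rightarrow> complex"
  assumes hol: "f holomorphic_on ball 0 r" and "f 0 = 0"
    and z: "norm z < r" and nz: "f z \<noteq> 0"
    and le: "\<And>u. norm u \<le> norm z \<Longrightarrow> norm (f u) \<le> norm (f z)"
  obtains m :: real where "1 \<le> m" "z * deriv f z = of_real m * f z"
proof -
  \<comment> \<open>After this normalisation the closed unit disc is mapped into itself and 1 is
    fixed. The derivative \<open>d\<close> at 1 is the required \<open>m\<close>, so it has to be
    real and at least 1.\<close>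
  define F where "F = (\<lambda>u. f (u * z) / f z)"
  define d where "d = z * deriv f z / f z"
  have in_ball: "u * z \<in> ball 0 r" if "norm u \<le> 1" for u
    using that z mult_right_mono[of "norm u" 1 "norm z"] by (simp add: norm_mult)
  have "(f has_field_derivative deriv f z) (at (1 * z))"
    using hol z by (simp add: holomorphic_derivI[of f "ball 0 r"])
  then have "((\<lambda>u. f (u * z)) has_field_derivative deriv f z * z) (at 1)"
    by (rule DERIV_chain2) (auto intro!: derivative_eq_intros)
  then have F1: "(F has_field_derivative d) (at 1)"
    unfolding F_def d_def by (auto intro!: derivative_eq_intros simp: nz)
  have norm_F: "norm (F u) \<le> 1" if "norm u \<le> 1" for u
    using le[of "u * z"] that mult_right_mono[of "norm u" 1 "norm z"] nz
    by (simp add: F_def norm_mult norm_divide)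
  have hol_F: "F holomorphic_on ball 0 1"
    unfolding F_def
    by (intro holomorphic_intros holomorphic_on_compose_gen[OF _ hol, unfolded o_def])
       (use in_ball nz in auto)
  have schwarz: "norm (F u) \<le> norm u" if u: "norm u < 1" for u
  \<comment> \<open>Only \<open>norm (F u) \<le> 1\<close> is known, while the Schwarz lemma asks
    for a strict bound; it is applied to \<open>k * F\<close> with \<open>k < 1\<close>, and
    \<open>k\<close> tends to 1.\<close>
  proof (rule field_le_mult_one_interval)
    fix k :: real
    assume k: "0 < k" "k < 1"
    have "norm (of_real k * F u) \<le> norm u"
    proof (rule Schwarz_Lemma(1))
      show "(\<lambda>u. of_real k * F u) holomorphic_on ball 0 1"
        by (intro holomorphic_intros hol_F)
      show "of_real k * F 0 = 0"
        using \<open>f 0 = 0\<close> by (simp add: F_def)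
      show "norm (of_real k * F v) < 1" if "norm v < 1" for v
        using le_less_trans[OF mult_left_le[OF norm_F[of v], of k]] that k by (simp add: norm_mult)
    qed (fact u)
    then show "k * norm (F u) \<le> norm u"
      using k by (simp add: norm_mult)
  qed
  have F_1: "F 1 = 1"
    using nz by (simp add: F_def)
  \<comment> \<open>On the unit circle \<open>Re F\<close> is largest at 1, so its tangential
    derivative \<open>Re (\<i> * d) = - Im d\<close> vanishes there.\<close>
  have "Im d = 0"
  proof -
    have "((\<lambda>x. F (exp (\<i> * x))) has_field_derivative d * (exp (\<i> * of_real 0) * \<i>)) (at (of_real 0))"
      by (rule DERIV_chain2[of F]) (use F1 in \<open>auto intro!: derivative_eq_intros\<close>)
    from has_vector_derivative_real_field[OF this]
    have "((\<lambda>t. F (cis t)) has_vector_derivative (\<i> * d)) (at 0)"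
      by (simp add: cis_conv_exp mult.commute)
    from bounded_linear.has_vector_derivative[OF bounded_linear_Re this]
    have D: "((\<lambda>t. Re (F (cis t))) has_real_derivative - Im d) (at 0)"
      by (simp add: has_real_derivative_iff_has_vector_derivative)
    have "Re (F (cis t)) \<le> Re (F (cis 0))" for t
      using norm_F[of "cis t"] complex_Re_le_cmod[of "F (cis t)"] F_1 by simp
    then have "- Im d = 0"
      by (intro DERIV_local_max[OF D zero_less_one]) simp
    then show ?thesis
      by simp
  qed
  \<comment> \<open>If \<open>Re d < 1\<close>, then \<open>Re (F t) - t\<close>, which is 0 at
    \<open>t = 1\<close>, would be positive slightly to the left of 1, against the Schwarz
    bound.\<close>
  moreover have "1 \<le> Re d"
  proof (rule ccontr)
    assume "\<not> 1 \<le> Re d"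
    have "((\<lambda>t. F (of_real t)) has_vector_derivative d) (at 1)"
      by (rule has_vector_derivative_real_field) (use F1 in simp)
    from bounded_linear.has_vector_derivative[OF bounded_linear_Re this]
    have "((\<lambda>t. Re (F (of_real t))) has_real_derivative Re d) (at 1)"
      by (simp add: has_real_derivative_iff_has_vector_derivative)
    then have "((\<lambda>t. Re (F (of_real t)) - t) has_real_derivative Re d - 1) (at 1)"
      by (intro DERIV_diff DERIV_ident)
    from DERIV_neg_dec_left[OF this]
    obtain e where e: "e > 0" "\<And>h. h > 0 \<Longrightarrow> h < e \<Longrightarrow>
        Re (F (of_real 1)) - 1 < Re (F (of_real (1 - h))) - (1 - h)"
      using \<open>\<not> 1 \<le> Re d\<close> by (meson diff_less_0_iff_less not_le)
    define h where "h = min (e / 2) (1 / 2)"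
    have h: "0 < h" "h < e" "h < 1"
      using e(1) by (auto simp: h_def)
    have "norm (of_real (1 - h) :: complex) = 1 - h"
      using h by (simp only: norm_of_real)
    then have "Re (F (of_real (1 - h))) \<le> 1 - h"
      using schwarz[of "of_real (1 - h)"] complex_Re_le_cmod[of "F (of_real (1 - h))"] h by linarith
    then show False
      using e(2)[OF h(1,2)] F_1 by simp
  qed
  moreover have "z * deriv f z = d * f z"
    using nz by (simp add: d_def)
  ultimately show ?thesis
    using that[of "Re d"] by (metis complex_is_Real_iff of_real_Re)
qed

text \<open>The mean value theorem for the real part of \<open>f / (b - a)\<close> along the segment
  from \<open>a\<close> to \<open>b\<close>: the derivative in the parameter is exactly
  \<open>Re f'\<close>.\<close>

lemma Re_difference_quotient_pos:
  fixes f :: "complex \<Rightarrow> complex"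
  assumes "convex S" "a \<in> S" "b \<in> S" "a \<noteq> b"
    and der: "\<And>z. z \<in> S \<Longrightarrow> (f has_field_derivative f' z) (at z)"
    and pos: "\<And>z. z \<in> S \<Longrightarrow> 0 < Re (f' z)"
  shows "0 < Re ((f b - f a) / (b - a))"
proof -
  define x where "x = (\<lambda>t. a + of_real t * (b - a))"
  have x: "x t \<in> S" if "0 \<le> t" "t \<le> 1" for t
  proof -
    have "x t = (1 - t) *\<^sub>R a + t *\<^sub>R b"
      by (simp add: x_def scaleR_conv_of_real algebra_simps)
    then show ?thesis
      using convexD_alt[OF assms(1-3) that] by simp
  qed
  have "((\<lambda>t. Re (f (x t) / (b - a))) has_real_derivative Re (f' (x t))) (at t)"
    if t: "0 \<le> t" "t \<le> 1" for t
  proof -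
    have "((\<lambda>t. f (x t)) has_vector_derivative ((b - a) * f' (x t))) (at t)"
      by (rule field_vector_diff_chain_at[of x "b - a" t f, unfolded o_def])
        (use der[OF x[OF t]] in \<open>auto intro!: derivative_eq_intros simp: x_def\<close>)
    then have "((\<lambda>t. f (x t) / (b - a)) has_vector_derivative (b - a) * f' (x t) / (b - a)) (at t)"
      by (rule has_vector_derivative_divide)
    from bounded_linear.has_vector_derivative[OF bounded_linear_Re this] show ?thesis
      using \<open>a \<noteq> b\<close> by (simp add: has_real_derivative_iff_has_vector_derivative)
  qed
  then obtain t where "0 < t" "t < 1"
    and "Re (f (x 1) / (b - a)) - Re (f (x 0) / (b - a)) = (1 - 0) * Re (f' (x t))"
    using MVT2[of 0 1 "\<lambda>t. Re (f (x t) / (b - a))" "\<lambda>t. Re (f' (x t))"] by auto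
  with pos[of "x t"] x[of t] show ?thesis
    by (simp add: x_def diff_divide_distrib)
qed

lemma disc_logarithm:
  assumes hol: "f holomorphic_on \<D>" and nz: "\<And>z. z \<in> \<D> \<Longrightarrow> f z \<noteq> 0" and "f 0 = 1"
  obtains L where "L holomorphic_on \<D>" "L 0 = 0" "\<And>z. z \<in> \<D> \<Longrightarrow> f z = exp (L z)"
    "\<And>z. z \<in> \<D> \<Longrightarrow> deriv L z = deriv f z / f z"
proof -
  have "simply_connected \<D>"
    by (simp add: convex_imp_simply_connected)
  then have "\<exists>L. L holomorphic_on \<D> \<and> (\<forall>z\<in>\<D>. f z = exp (L z))"
    using hol nz unfolding simply_connected_eq_holomorphic_log[OF open_ball] by blast
  then obtain L0 where L0: "L0 holomorphic_on \<D>" "\<And>z. z \<in> \<D> \<Longrightarrow> f z = exp (L0 z)"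
    by blast
  define L where "L = (\<lambda>z. L0 z - L0 0)"
  have hol_L: "L holomorphic_on \<D>"
    unfolding L_def by (intro holomorphic_intros L0)
  have f_L: "f z = exp (L z)" if "z \<in> \<D>" for z
    using L0(2)[OF that] L0(2)[of 0] \<open>f 0 = 1\<close> by (simp add: L_def exp_diff)
  have "deriv L z = deriv f z / f z" if z: "z \<in> \<D>" for z
  proof -
    have "((\<lambda>u. exp (L u)) has_field_derivative exp (L z) * deriv L z) (at z)"
      by (rule derivative_eq_intros holomorphic_derivI[OF hol_L open_ball z] refl)+
    then have "(f has_field_derivative exp (L z) * deriv L z) (at z)"
      by (rule has_field_derivative_transform_within_open[OF _ open_ball z]) (use f_L in auto)
    then show ?thesis
      using f_L[OF z] by (simp add: DERIV_imp_deriv)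
  qed
  then show ?thesis
    using that[of L] hol_L f_L by (simp add: L_def)
qed

subsection \<open>Convex maps of the disc\<close>

locale convex_map =
  fixes g :: "complex \<Rightarrow> complex"
  assumes hol: "g holomorphic_on \<D>"
    and deriv_nz: "z \<in> \<D> \<Longrightarrow> deriv g z \<noteq> 0"
    and convex: "z \<in> \<D> \<Longrightarrow> 0 < Re (1 + z * deriv (deriv g) z / deriv g z)"
begin

lemma has_deriv: "z \<in> \<D> \<Longrightarrow> (g has_field_derivative deriv g z) (at z)"
  by (rule holomorphic_derivI[OF hol]) auto

lemma has_deriv2: "z \<in> \<D> \<Longrightarrow> (deriv g has_field_derivative deriv (deriv g) z) (at z)"
  by (rule holomorphic_derivI[OF holomorphic_deriv[OF hol]]) auto

text \<open>The argument of the normal \<open>z * deriv g z\<close> increases by exactly \<open>2\<pi>\<close> along a circle,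
  so a linear functional of \<open>g\<close> first decreases and then increases along it.\<close>

lemma circle_support:
  assumes z: "norm z < 1" "z \<noteq> 0" and v: "norm v = norm z" "v \<noteq> z"
  shows "(z * deriv g z) \<bullet> (g v - g z) < 0"
proof -
  obtain K where K: "K holomorphic_on \<D>" "\<And>u. u \<in> \<D> \<Longrightarrow> deriv g u = exp (K u)"
  proof -
    have "simply_connected \<D>"
      by (simp add: convex_imp_simply_connected)
    moreover have "deriv g holomorphic_on \<D> \<and> (\<forall>z\<in>\<D>. deriv g z \<noteq> 0)"
      using hol deriv_nz holomorphic_deriv by blast
    ultimately have "\<exists>K. K holomorphic_on \<D> \<and> (\<forall>z\<in>\<D>. deriv g z = exp (K z))"
      unfolding simply_connected_eq_holomorphic_log[OF open_ball] by blast
    then show ?thesis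
      using that by blast
  qed
  define N where "N = z * deriv g z"
  define c where "c = (\<lambda>t. z * cis t)"
  \<comment> \<open>Up to the constant argument of \<open>z\<close>, this is a continuous argument
    of the normal \<open>c t * deriv g (c t)\<close>; the convexity condition makes it strictly
    increasing.\<close>
  define \<alpha> where "\<alpha> = (\<lambda>t. t + Im (K (c t)))"
  define \<phi> where "\<phi> = (\<lambda>t. N \<bullet> (g (c t) - g z))"
  have c_disc: "c t \<in> \<D>" for t
    using z by (simp add: c_def norm_mult)
  have chain: "((\<lambda>t. f (c t)) has_vector_derivative \<i> * c t * f') (at t)"
    if "(f has_field_derivative f') (at (c t))" for f f' t
  proof -
    have "((\<lambda>x. f (z * exp (\<i> * x))) has_field_derivative f' * (z * (exp (\<i> * of_real t) * \<i>)))
        (at (of_real t))"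
      by (rule DERIV_chain2[of f])
        (use that in \<open>auto intro!: derivative_eq_intros simp: c_def cis_conv_exp\<close>)
    from has_vector_derivative_real_field[OF this] show ?thesis
      by (simp add: c_def cis_conv_exp mult_ac)
  qed
  have K': "(K has_field_derivative deriv (deriv g) u / deriv g u) (at u)" if u: "u \<in> \<D>" for u
  proof -
    have K1: "(K has_field_derivative deriv K u) (at u)"
      using K(1) u by (auto intro: holomorphic_derivI)
    have "((\<lambda>u. exp (K u)) has_field_derivative exp (K u) * deriv K u) (at u)"
      by (rule derivative_eq_intros K1 refl)+
    then have "(deriv g has_field_derivative exp (K u) * deriv K u) (at u)"
      by (rule has_field_derivative_transform_within_open[where S = \<D>]) (use u K(2) in auto)
    then have "deriv (deriv g) u = exp (K u) * deriv K u"
      by (rule DERIV_imp_deriv)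
    then show ?thesis
      using K1 K(2)[OF u] by simp
  qed
  have \<alpha>': "(\<alpha> has_real_derivative Re (1 + c t * deriv (deriv g) (c t) / deriv g (c t))) (at t)" for t
  proof -
    define l where "l = c t * deriv (deriv g) (c t) / deriv g (c t)"
    have "((\<lambda>t. K (c t)) has_vector_derivative \<i> * l) (at t)"
      using chain[OF K'[OF c_disc]] by (simp add: l_def mult.assoc)
    from bounded_linear.has_vector_derivative[OF bounded_linear_Im this]
    have "((\<lambda>t. Im (K (c t))) has_real_derivative Re l) (at t)"
      by (simp add: has_real_derivative_iff_has_vector_derivative)
    from DERIV_add[OF DERIV_ident this] show ?thesis
      by (simp add: \<alpha>_def l_def)
  qed
  have \<alpha>_mono: "\<alpha> s < \<alpha> t" if "s < t" for s t
    by (rule DERIV_pos_imp_increasing[OF that]) (rule exI, rule conjI[OF \<alpha>' convex[OF c_disc]])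
  \<comment> \<open>The tangent at \<open>g (c t)\<close> is the normal there turned by a right
    angle. Its inner product with \<open>N\<close> is the product \<open>r\<close> of the moduli of
    the two normals times the cosine of \<open>\<alpha> t - \<alpha> 0 + pi / 2\<close>.\<close>
  have \<phi>': "\<exists>r>0. (\<phi> has_real_derivative - (r * sin (\<alpha> t - \<alpha> 0))) (at t)" for t
  proof -
    define r where "r = norm z ^ 2 * exp (Re (K (c t)) + Re (K z))"
    have "(\<phi> has_real_derivative N \<bullet> (\<i> * c t * deriv g (c t))) (at t)"
    proof -
      have "((\<lambda>t. g (c t) - g z) has_vector_derivative \<i> * c t * deriv g (c t)) (at t)"
        using chain[OF has_deriv[OF c_disc]] by (auto intro!: derivative_eq_intros)
      from bounded_linear.has_vector_derivative[OF bounded_linear_inner_right this]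
      show ?thesis
        by (simp add: \<phi>_def has_real_derivative_iff_has_vector_derivative)
    qed
    also have "N \<bullet> (\<i> * c t * deriv g (c t)) = Re (\<i> * c t * deriv g (c t) * cnj N)"
      by (simp add: inner_complex_def)
    also have "\<i> * c t * deriv g (c t) * cnj N
        = \<i> * ((z * cnj z) * exp (\<i> * of_real t + K (c t) + cnj (K z)))"
      using z K(2)[of z] K(2)[OF c_disc[of t]] by (simp add: N_def c_def cis_conv_exp exp_add exp_cnj)
    also have "exp (\<i> * of_real t + K (c t) + cnj (K z))
        = of_real (exp (Re (K (c t)) + Re (K z))) * cis (\<alpha> t - \<alpha> 0)"
      by (simp add: exp_eq_polar \<alpha>_def c_def algebra_simps flip: of_real_add)
    also have "Re (\<i> * ((z * cnj z) * \<dots>)) = - (r * sin (\<alpha> t - \<alpha> 0))"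
      by (simp add: r_def complex_norm_square[symmetric] del: of_real_power flip: of_real_power of_real_mult)
    finally show ?thesis
      using z by (intro exI[of _ r]) (simp add: r_def)
  qed
  have neg: "\<exists>y. (\<phi> has_real_derivative y) (at s) \<and> y < 0" if "0 < sin (\<alpha> s - \<alpha> 0)" for s
  proof -
    obtain r where "r > 0" "(\<phi> has_real_derivative - (r * sin (\<alpha> s - \<alpha> 0))) (at s)"
      using \<phi>' by blast
    with that show ?thesis
      by (intro exI[of _ "- (r * sin (\<alpha> s - \<alpha> 0))"] conjI) simp_all
  qed
  have pos: "\<exists>y. (\<phi> has_real_derivative y) (at s) \<and> 0 < y" if "sin (\<alpha> s - \<alpha> 0) < 0" for s
  proof -
    obtain r where "r > 0" "(\<phi> has_real_derivative - (r * sin (\<alpha> s - \<alpha> 0))) (at s)"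
      using \<phi>' by blast
    with that show ?thesis
      by (intro exI[of _ "- (r * sin (\<alpha> s - \<alpha> 0))"] conjI) (simp_all add: mult_less_0_iff)
  qed
  have cont: "continuous_on S \<phi>" for S
    by (intro continuous_at_imp_continuous_on ballI) (use \<phi>' DERIV_isCont in blast)
  obtain t where t: "0 < t" "t < 2 * pi" "v = c t"
  proof -
    define a where "a = Arg2pi (v / z)"
    have "v / z = cis a"
      using Arg2pi_eq[of "v / z"] v z by (simp add: a_def norm_divide cis_conv_exp)
    then have va: "v = c a"
      using z by (simp add: c_def field_simps)
    moreover have "a \<noteq> 0"
      using va v by (auto simp: c_def)
    ultimately show ?thesis
      using that[of a] Arg2pi_ge_0[of "v / z"] Arg2pi_lt_2pi[of "v / z"] unfolding a_def by linarith
  qed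
  have per: "\<alpha> (2 * pi) = \<alpha> 0 + 2 * pi" "\<phi> 0 = 0" "\<phi> (2 * pi) = 0"
    by (simp_all add: \<alpha>_def \<phi>_def c_def)
  \<comment> \<open>\<open>\<phi>\<close> vanishes at 0 and at \<open>2 * pi\<close>. If the normal
    has turned by at most \<open>pi\<close>, \<open>\<phi>\<close> has only fallen since 0;
    otherwise it only rises until \<open>2 * pi\<close>.\<close>
  have "\<phi> t < 0"
  proof (cases "\<alpha> t - \<alpha> 0 \<le> pi")
    case True
    have "\<phi> t < \<phi> 0"
    proof (rule DERIV_neg_imp_decreasing_open[OF t(1)])
      fix s assume "0 < s" "s < t"
      then have "0 < sin (\<alpha> s - \<alpha> 0)"
        using \<alpha>_mono[of 0 s] \<alpha>_mono[of s t] True by (intro sin_gt_zero) auto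
      then show "\<exists>y. (\<phi> has_real_derivative y) (at s) \<and> y < 0"
        by (rule neg)
    qed (rule cont)
    then show ?thesis by (simp add: per)
  next
    case False
    have "\<phi> t < \<phi> (2 * pi)"
    proof (rule DERIV_pos_imp_increasing_open[OF t(2)])
      fix s assume s: "t < s" "s < 2 * pi"
      then have "sin (\<alpha> s - \<alpha> 0) < 0"
        using \<alpha>_mono[of t s] \<alpha>_mono[of s "2 * pi"] False per by (intro sin_lt_zero) auto
      then show "\<exists>y. (\<phi> has_real_derivative y) (at s) \<and> 0 < y"
        by (rule pos)
    qed (rule cont)
    then show ?thesis by (simp add: per)
  qed
  then show ?thesis
    by (simp add: \<phi>_def t(3) N_def)
qed

text \<open>The inner product of the normal with \<open>g\<close> is the real part of an analytic
  function, so the maximum principle carries the bound on the circle to its interior, where the open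
  mapping theorem excludes equality.\<close>

lemma support:
  assumes z: "norm z < 1" "z \<noteq> 0" and v: "norm v \<le> norm z" "v \<noteq> z"
  shows "(z * deriv g z) \<bullet> (g v - g z) < 0"
proof (cases "norm v = norm z")
  case True
  with assms show ?thesis by (intro circle_support) auto
next
  case False
  define N where "N = z * deriv g z"
  define B where "B = ball (0::complex) (norm z)"
  have N: "N \<noteq> 0"
    using z deriv_nz by (simp add: N_def)
  have B: "B \<subseteq> \<D>" "closure B \<subseteq> \<D>"
    using z by (auto simp: B_def)
  have inner_Re: "N \<bullet> u = Re (u * cnj N)" for u
    by (simp add: inner_complex_def)
  have le: "N \<bullet> g u \<le> N \<bullet> g z" if "u \<in> B" for u
    unfolding inner_Re
  proof (rule maximum_real_frontier[OF _ _ _ _ that])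
    show "(\<lambda>u. g u * cnj N) holomorphic_on interior B"
      using B by (intro holomorphic_intros holomorphic_on_subset[OF hol]) (simp add: B_def)
    show "continuous_on (closure B) (\<lambda>u. g u * cnj N)"
      using B by (intro continuous_intros continuous_on_subset[OF holomorphic_on_imp_continuous_on[OF hol]])
    show "bounded B"
      by (simp add: B_def)
    show "Re (g u * cnj N) \<le> Re (g z * cnj N)" if "u \<in> frontier B" for u
    proof (cases "u = z")
      case False
      have "norm u = norm z"
        using that z by (simp add: B_def)
      from circle_support[OF z this False] show ?thesis
        by (simp add: N_def inner_complex_def algebra_simps)
    qed simp
  qed
  have "\<not> g constant_on \<D>"
  proof
    assume "g constant_on \<D>"
    then obtain k where "\<And>u. u \<in> \<D> \<Longrightarrow> g u = k"
      by (auto simp: constant_on_def)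
    then have "deriv g 0 = deriv (\<lambda>u. k) 0"
      by (intro deriv_cong_ev) (auto simp: eventually_nhds intro!: exI[of _ \<D>])
    then show False
      using deriv_nz[of 0] by simp
  qed
  then have "open (g ` B)"
    using B by (intro open_mapping_thm[OF hol]) (auto simp: B_def)
  then have "g ` B \<subseteq> interior {u. N \<bullet> u \<le> N \<bullet> g z}"
    using le by (intro interior_maximal) auto
  moreover have "v \<in> B"
    using False v by (simp add: B_def)
  ultimately show ?thesis
    using N by (auto simp: inner_diff_right N_def)
qed

section \<open>Univalence and convexity of the images of discs\<close>

lemma inj: "inj_on g \<D>"
proof -
  have "g v \<noteq> g z" if "norm z < 1" "norm v \<le> norm z" "v \<noteq> z" for v z
  proof -
    have "z \<noteq> 0"
      using that by auto
    from support[OF that(1) this that(2,3)] show ?thesis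
      by auto
  qed
  then show ?thesis
    unfolding inj_on_def by (metis linear mem_ball_0)
qed

lemma open_image: "open U \<Longrightarrow> U \<subseteq> \<D> \<Longrightarrow> open (g ` U)"
  by (meson hol holomorphic_on_subset inj inj_on_subset open_mapping_thm3)

text \<open>The image is open and closed in the intersection \<open>C\<close> of the supporting open
  half planes; as \<open>C\<close> is convex, hence connected, the two coincide.\<close>

lemma convex_image:
  assumes R: "0 < R" "R < 1"
  shows "convex (g ` ball 0 R)"
proof -
  define H where "H = (\<lambda>z. {u. (z * deriv g z) \<bullet> u < (z * deriv g z) \<bullet> g z})"
  define C where "C = (\<Inter>z\<in>sphere 0 R. H z)"
  have sub: "g ` ball 0 R \<subseteq> C"
  proof -
    have "(z * deriv g z) \<bullet> g v < (z * deriv g z) \<bullet> g z" if "norm z = R" "norm v < R" for z v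
      using support[of z v] that R by (cases "v = z") (auto simp: inner_diff_right)
    then show ?thesis
      by (auto simp: C_def H_def)
  qed
  have "convex C"
    unfolding C_def H_def by (intro convex_INT convex_halfspace_lt)
  \<comment> \<open>The image of a point of the circle lies on the boundary of its own half plane,
    hence outside \<open>C\<close>. So \<open>C\<close> meets the compact image of the closed disc
    exactly in the image of the open disc.\<close>
  have "C \<inter> g ` cball 0 R = g ` ball 0 R"
  proof -
    have "g z \<notin> C" if "norm z = R" for z
      using that by (auto simp: C_def H_def)
    then have "norm z < R" if "norm z \<le> R" "g z \<in> C" for z
      using that by (metis order_le_less)
    then show ?thesis
      using sub by auto
  qed
  moreover have "compact (g ` cball 0 R)"
    using R by (intro compact_continuous_image continuous_on_subset[OF holomorphic_on_imp_continuous_on[OF hol]]) auto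
  ultimately have "closedin (top_of_set C) (g ` ball 0 R)"
    by (metis closedin_closed compact_imp_closed)
  moreover have "openin (top_of_set C) (g ` ball 0 R)"
    using R sub by (intro open_subset open_image) auto
  ultimately have "g ` ball 0 R = C"
    using convex_connected[OF \<open>convex C\<close>] R unfolding connected_clopen by auto
  with \<open>convex C\<close> show ?thesis
    by simp
qed

text \<open>Along a ray in the normal direction at \<open>g z\<close> the function \<open>\<theta> \<circ> g + z g'\<close>, read in the
  coordinate \<open>g\<close> where its derivative has positive real part, cannot return to the convex domain
  bounded by the image of the circle through \<open>z\<close>.\<close>

lemma normal_ray_avoids:
  fixes \<theta> :: "complex \<Rightarrow> complex" and t :: real
  assumes hol\<theta>: "\<theta> holomorphic_on UNIV"
    and pos: "\<And>z. z \<in> \<D> \<Longrightarrow> 0 < Re (deriv \<theta> (g z) + (1 + z * deriv (deriv g) z / deriv g z))"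
    and z: "norm z < 1" and v: "norm v < norm z" and t: "0 \<le> t"
  shows "\<theta> (g v) + v * deriv g v \<noteq> \<theta> (g z) + z * deriv g z + of_real t * (z * deriv g z)"
proof
  assume eq: "\<theta> (g v) + v * deriv g v = \<theta> (g z) + z * deriv g z + of_real t * (z * deriv g z)"
  define N where "N = z * deriv g z"
  \<comment> \<open>\<open>g z\<close> is only a boundary point of the image of
    \<open>ball 0 (norm z)\<close>. A radius strictly between \<open>norm z\<close> and 1 puts
    \<open>g v\<close> and \<open>g z\<close> into one open convex set.\<close>
  define R where "R = (1 + norm z) / 2"
  have R: "0 < R" "norm z < R" "R < 1"
    using z by (simp_all add: R_def add_pos_nonneg)
  have R_sub: "ball 0 R \<subseteq> \<D>"
    using R by auto
  have z0: "z \<noteq> 0"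
    using v by auto
  have supp: "N \<bullet> (g v - g z) < 0"
    unfolding N_def using z z0 v by (intro support) auto
  obtain k where k: "\<And>u. u \<in> \<D> \<Longrightarrow> k (g u) = u" "\<And>u. u \<in> \<D> \<Longrightarrow> deriv g u * deriv k (g u) = 1"
    and hol_k: "k holomorphic_on g ` \<D>"
    using holomorphic_has_inverse[OF hol open_ball inj] by metis
  define H where "H = (\<lambda>x. \<theta> x + k x * deriv g (k x))"
  \<comment> \<open>Since \<open>k' = 1 / g'\<close>, differentiating the summand
    \<open>k * g'(k)\<close> of \<open>H\<close> gives \<open>1 + z g'' / g'\<close>, and
    \<open>pos\<close> becomes \<open>Re H' > 0\<close>.\<close>
  define H' where "H' = (\<lambda>x. deriv \<theta> x + (1 + k x * deriv (deriv g) (k x) / deriv g (k x)))"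
  have H': "(H has_field_derivative H' (g u)) (at (g u))" if u: "u \<in> \<D>" for u
  proof -
    have dk: "(k has_field_derivative 1 / deriv g u) (at (g u))"
    proof -
      have "(k has_field_derivative deriv k (g u)) (at (g u))"
        using u by (intro holomorphic_derivI[OF hol_k] open_image) auto
      moreover have "deriv k (g u) = 1 / deriv g u"
        using k(2)[OF u] deriv_nz[OF u] by (simp add: field_simps)
      ultimately show ?thesis by simp
    qed
    have "((\<lambda>x. deriv g (k x)) has_field_derivative deriv (deriv g) u * (1 / deriv g u)) (at (g u))"
      by (rule DERIV_chain2[OF _ dk]) (use has_deriv2[OF u] k(1)[OF u] in simp)
    from DERIV_add[OF holomorphic_derivI[OF hol\<theta> open_UNIV UNIV_I] DERIV_mult[OF dk this]]
    have "(H has_field_derivative deriv \<theta> (g u) + (1 / deriv g u * deriv g (k (g u))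
        + deriv (deriv g) u * (1 / deriv g u) * k (g u))) (at (g u))"
      unfolding H_def by simp
    then show ?thesis
      using k(1)[OF u] deriv_nz[OF u] by (simp add: H'_def mult_ac)
  qed
  have ne: "g z \<noteq> g v"
    using supp by auto
  define A where "A = (H (g v) - H (g z)) / (g v - g z)"
  have A: "0 < Re A"
    unfolding A_def
  proof (rule Re_difference_quotient_pos[OF convex_image[OF R(1,3)] _ _ ne])
    show "(H has_field_derivative H' x) (at x)" if "x \<in> g ` ball 0 R" for x
      using that R_sub H' by auto
    show "0 < Re (H' x)" if "x \<in> g ` ball 0 R" for x
    proof -
      from that obtain u where u: "u \<in> \<D>" "x = g u"
        using R_sub by blast
      then show ?thesis
        using pos[OF u(1)] k(1)[OF u(1)] by (simp add: H'_def)
    qed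
  qed (use R v in auto)
  \<comment> \<open>This yields \<open>A * (g v - g z) = t * N\<close>, so the inner product of
    \<open>N\<close> with \<open>g v - g z\<close> is \<open>t * |N|^2 * Re (1 / A)\<close>, which
    is nonnegative, against \<open>supp\<close>.\<close>
  have "H (g v) - H (g z) = of_real t * N"
    using eq k(1)[of v] k(1)[of z] z v by (simp add: H_def N_def)
  then have "A * (g v - g z) = of_real t * N"
    using ne by (simp add: A_def)
  moreover have "A \<noteq> 0"
    using A by auto
  ultimately have "g v - g z = of_real t * N / A"
    by (simp add: nonzero_eq_divide_eq mult.commute)
  moreover have "N \<bullet> (g v - g z) = Re ((g v - g z) * cnj N)"
    by (simp add: inner_complex_def)
  ultimately have "N \<bullet> (g v - g z) = Re (of_real t * (N * cnj N) / A)"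
    by (simp add: mult_ac)
  also have "\<dots> = t * norm N ^ 2 * (Re A / norm A ^ 2)"
    by (simp add: complex_norm_square[symmetric] Re_divide cmod_power2 del: of_real_power flip: of_real_power of_real_mult)
  also have "\<dots> \<ge> 0"
    using t A by simp
  finally show False
    using supp by simp
qed

section \<open>Subordination to a convex map\<close>

theorem subordination:
  fixes P w \<theta> :: "complex \<Rightarrow> complex"
  assumes hol\<theta>: "\<theta> holomorphic_on UNIV"
    and pos: "\<And>z. z \<in> \<D> \<Longrightarrow> 0 < Re (deriv \<theta> (g z) + (1 + z * deriv (deriv g) z / deriv g z))"
    and holP: "P holomorphic_on \<D>" and P0: "P 0 = g 0"
    and holw: "w holomorphic_on \<D>" and w: "w ` \<D> \<subseteq> \<D>" "w 0 = 0"
    and eq: "\<And>z. z \<in> \<D> \<Longrightarrow> \<theta> (P z) + z * deriv P z = \<theta> (g (w z)) + w z * deriv g (w z)"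
  shows "P \<prec> g"
proof -
  obtain k where k: "\<And>u. u \<in> \<D> \<Longrightarrow> k (g u) = u" and hol_k: "k holomorphic_on g ` \<D>"
    using holomorphic_has_inverse[OF hol open_ball inj] by metis
  have gk: "g (k x) = x" "norm (k x) < 1" if "x \<in> g ` \<D>" for x
    using that k by auto
  \<comment> \<open>The inverse \<open>k\<close> is meaningful only on the image of
    \<open>g\<close>, so \<open>\<omega>\<close> is first bounded on discs that \<open>P\<close>
    maps into that image.\<close>
  define \<omega> where "\<omega> = k \<circ> P"
  have \<omega>0: "\<omega> 0 = 0"
    using k[of 0] by (simp add: \<omega>_def P0)
  have norm_w: "norm (w z) \<le> norm z" if "norm z < 1" for z
    using Schwarz_Lemma(1)[OF holw w(2) _ that] w(1) by (auto simp: image_subset_iff)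
  have le: "norm (\<omega> z) \<le> norm z"
    if r: "r \<le> 1" "norm z < r" and sub: "P ` ball 0 r \<subseteq> g ` \<D>" for r z
  proof (rule ccontr)
    assume less: "\<not> norm (\<omega> z) \<le> norm z"
    have r_sub: "ball 0 r \<subseteq> \<D>"
      using r by auto
    have hol\<omega>: "\<omega> holomorphic_on ball 0 r"
      unfolding \<omega>_def
      by (rule holomorphic_on_compose_gen[OF holomorphic_on_subset[OF holP r_sub] hol_k sub])
    have g\<omega>: "g (\<omega> u) = P u" "norm (\<omega> u) < 1" if "u \<in> ball 0 r" for u
      using gk[OF subsetD[OF sub imageI[OF that]]] by (simp_all add: \<omega>_def)
    \<comment> \<open>The maximum is taken over the whole closed disc, so that Jack's lemma applies
      at \<open>x\<close> and \<open>norm x \<le> norm z < norm (\<omega> z) \<le> norm (\<omega>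
      x)\<close>.\<close>
    have "\<exists>x\<in>cball 0 (norm z). \<forall>u\<in>cball 0 (norm z). norm (\<omega> u) \<le> norm (\<omega> x)"
      using r by (intro continuous_attains_sup continuous_intros
          continuous_on_subset[OF holomorphic_on_imp_continuous_on[OF hol\<omega>]]) auto
    then obtain x where x: "norm x \<le> norm z" "\<And>u. norm u \<le> norm z \<Longrightarrow> norm (\<omega> u) \<le> norm (\<omega> x)"
      by auto
    have gt: "norm x < norm (\<omega> x)"
      using x(1) x(2)[of z] less by simp
    have xr: "x \<in> ball 0 r" "x \<in> \<D>"
      using x r by auto
    obtain m where m: "1 \<le> m" "x * deriv \<omega> x = of_real m * \<omega> x"
    proof (rule jack[OF hol\<omega> \<omega>0])
      show "norm x < r" "\<omega> x \<noteq> 0"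
        using xr gt by auto
      show "norm (\<omega> u) \<le> norm (\<omega> x)" if "norm u \<le> norm x" for u
        using x that by auto
    qed
    have "(g has_field_derivative deriv g (\<omega> x)) (at (\<omega> x))"
      using has_deriv g\<omega>(2)[OF xr(1)] by simp
    from DERIV_chain2[OF this holomorphic_derivI[OF hol\<omega> open_ball xr(1)]]
    have "(P has_field_derivative deriv g (\<omega> x) * deriv \<omega> x) (at x)"
      by (rule has_field_derivative_transform_within_open[OF _ open_ball xr(1)]) (use g\<omega> in auto)
    then have "x * deriv P x = of_real m * (\<omega> x * deriv g (\<omega> x))"
      using m by (simp add: DERIV_imp_deriv algebra_simps)
    \<comment> \<open>One copy of the normal is split off, leaving the ray parameter
      \<open>m - 1 \<ge> 0\<close>. By the Schwarz lemma
      \<open>norm (w x) \<le> norm x < norm (\<omega> x)\<close>, so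
      \<open>normal_ray_avoids\<close> applies at \<open>\<omega> x\<close>.\<close>
    then have "\<theta> (g (w x)) + w x * deriv g (w x)
        = \<theta> (g (\<omega> x)) + \<omega> x * deriv g (\<omega> x) + of_real (m - 1) * (\<omega> x * deriv g (\<omega> x))"
      using eq[OF xr(2)] g\<omega>(1)[OF xr(1)] by (simp add: algebra_simps)
    moreover have "norm (w x) < norm (\<omega> x)"
      using norm_w[of x] gt xr by simp
    ultimately show False
      using normal_ray_avoids[OF hol\<theta> pos g\<omega>(2)[OF xr(1)], of "w x" "m - 1"] m by simp
  qed
  have sub: "P ` \<D> \<subseteq> g ` \<D>"
  proof (rule ccontr)
    assume "\<not> P ` \<D> \<subseteq> g ` \<D>"
    then obtain y where "y \<in> \<D>" "P y \<notin> g ` \<D>"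
      by blast
    then have y: "norm y < 1" "P y \<notin> g ` \<D>"
      by simp_all
    \<comment> \<open>If \<open>P\<close> leaves the image of \<open>g\<close>, there is an exit
      point \<open>x\<close> of least modulus \<open>r\<close>. On \<open>ball 0 r\<close> the bound
      on \<open>\<omega>\<close> keeps \<open>P\<close> in the compact image of
      \<open>cball 0 r\<close>, and by continuity \<open>P x\<close> lies there too.\<close>
    define E where "E = cball 0 (norm y) \<inter> P -` (- g ` \<D>)"
    have "compact E"
      unfolding E_def compact_eq_bounded_closed
    proof
      show "closed (cball 0 (norm y) \<inter> P -` (- g ` \<D>))"
        using y(1) by (intro continuous_closed_preimage closed_cball
            continuous_on_subset[OF holomorphic_on_imp_continuous_on[OF holP]])
          (auto simp: closed_Compl intro!: open_image)
    qed (auto intro: bounded_subset[OF bounded_cball])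
    moreover have "y \<in> E"
      using y by (simp add: E_def)
    ultimately obtain x where x: "x \<in> E" "\<And>u. u \<in> E \<Longrightarrow> norm x \<le> norm u"
      using continuous_attains_inf[of E norm] by (auto intro: continuous_intros)
    define r where "r = norm x"
    have r: "r < 1" "r \<le> norm y"
      using x(2)[OF \<open>y \<in> E\<close>] y(1) by (auto simp: r_def)
    have "P 0 \<in> g ` \<D>"
      by (simp add: P0)
    then have x0: "x \<noteq> 0"
      using x by (auto simp: E_def)
    have sub: "P ` ball 0 r \<subseteq> g ` \<D>"
    proof -
      have "u \<notin> E" if "norm u < r" for u
        using x(2)[of u] that by (auto simp: r_def)
      then show ?thesis
        using r by (auto simp: E_def)
    qed
    have "P u \<in> g ` cball 0 r" if "u \<in> ball 0 r" for u
    proof -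
      have "g (\<omega> u) = P u"
        using gk(1)[OF subsetD[OF sub imageI[OF that]]] by (simp_all add: \<omega>_def)
      moreover have "\<omega> u \<in> cball 0 r"
        using le[of r u] r sub that by simp
      ultimately show ?thesis
        by (metis imageI)
    qed
    moreover have "continuous_on (closure (ball 0 r)) P"
      using r x0 by (intro continuous_on_subset[OF holomorphic_on_imp_continuous_on[OF holP]]) (auto simp: r_def)
    moreover have "closed (g ` cball 0 r)"
      using r by (intro compact_imp_closed compact_continuous_image
          continuous_on_subset[OF holomorphic_on_imp_continuous_on[OF hol]]) auto
    ultimately have "P ` closure (ball 0 r) \<subseteq> g ` cball 0 r"
      by (intro image_closure_subset) auto
    moreover have "x \<in> closure (ball 0 r)"
      using x0 by (simp add: r_def)
    ultimately have "P x \<in> g ` \<D>"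
      using r by auto
    then show False
      using x by (simp add: E_def)
  qed
  have "norm (\<omega> z) < 1 \<and> P z = g (\<omega> z)" if "z \<in> \<D>" for z
    using gk[OF subsetD[OF sub imageI[OF that]]] by (simp_all add: \<omega>_def)
  moreover have "\<omega> holomorphic_on \<D>"
    unfolding \<omega>_def by (rule holomorphic_on_compose_gen[OF holP hol_k sub])
  ultimately show ?thesis
    unfolding subordinate_def using holP hol \<omega>0 by auto
qed

end

subsection \<open>Hyperbolic functions of the square root\<close>

lemma cosh_sums_even:
  fixes s :: "'a::{real_normed_field,banach}"
  shows "(\<lambda>n. 1 / fact (2 * n) * (s\<^sup>2) ^ n) sums cosh s"
proof -
  have "(\<lambda>n. if even n then s ^ n /\<^sub>R fact n else 0) sums cosh s"
    by (rule cosh_converges)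
  then show ?thesis
    by (subst (asm) sums_mono_reindex [of "\<lambda>n. 2 * n", symmetric])
      (auto simp: strict_mono_def scaleR_conv_of_real field_simps simp flip: power_mult elim!: evenE)
qed

lemma sinh_sums_odd:
  fixes s :: "'a::{real_normed_field,banach}"
  shows "(\<lambda>n. s * (1 / fact (2 * n + 1) * (s\<^sup>2) ^ n)) sums sinh s"
proof -
  have "(\<lambda>n. if even n then 0 else s ^ n /\<^sub>R fact n) sums sinh s"
    by (rule sinh_converges)
  then show ?thesis
    by (subst (asm) sums_mono_reindex [of "\<lambda>n. 2 * n + 1", symmetric])
      (auto simp: strict_mono_def scaleR_conv_of_real field_simps simp flip: power_mult elim!: oddE)
qed

text \<open>The entire function \<open>sinh \<surd>z / \<surd>z\<close>, twice the derivative of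
  \<open>cosh_sqrt\<close>; it expresses the derivatives below without a branch of the square
  root.\<close>

definition sinhc_sqrt :: "complex \<Rightarrow> complex"
  where "sinhc_sqrt z = (\<Sum>n. 1 / fact (2 * n + 1) * z ^ n)"

lemma cosh_sqrt_sums: "(\<lambda>n. 1 / fact (2 * n) * z ^ n) sums cosh_sqrt z"
  using cosh_sums_even[of "csqrt z"] by (simp add: cosh_sqrt_def sums_iff)

lemma sinhc_sqrt_sums: "(\<lambda>n. 1 / fact (2 * n + 1) * z ^ n) sums sinhc_sqrt z"
proof (cases "z = 0")
  case True
  then show ?thesis
    using powser_sums_zero[of "\<lambda>n. 1 / fact (2 * n + 1) :: complex"] unfolding sinhc_sqrt_def
    by (simp only: sums_iff)
next
  case False
  then have "summable (\<lambda>n. 1 / fact (2 * n + 1) * z ^ n)"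
    using sums_mult_D[OF sinh_sums_odd[of "csqrt z"]] by (simp add: sums_iff)
  then show ?thesis
    unfolding sinhc_sqrt_def by (rule summable_sums)
qed

lemma sinhc_sqrt_power2: "s * sinhc_sqrt (s\<^sup>2) = sinh s"
  using sums_unique2[OF sums_mult[OF sinhc_sqrt_sums] sinh_sums_odd] .

lemma cosh_sqrt_0 [simp]: "cosh_sqrt 0 = 1"
  using cosh_sqrt_power2[of 0] by simp

lemma sinhc_sqrt_0 [simp]: "sinhc_sqrt 0 = 1"
  using powser_zero[of "\<lambda>n. 1 / fact (2 * n + 1) :: complex"] by (simp add: sinhc_sqrt_def)

lemma has_field_derivative_cosh_sqrt:
  "(cosh_sqrt has_field_derivative sinhc_sqrt z / 2) (at z)"
proof -
  define c :: "nat \<Rightarrow> complex" where "c = (\<lambda>n. 1 / fact (2 * n))"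
  have "((\<lambda>z. \<Sum>n. c n * z ^ n) has_field_derivative (\<Sum>n. diffs c n * z ^ n)) (at z)"
    using cosh_sqrt_sums
    by (intro termdiffs_strong_converges_everywhere) (auto simp: c_def sums_iff)
  moreover have "(\<lambda>z. \<Sum>n. c n * z ^ n) = cosh_sqrt"
    by (simp add: c_def cosh_sqrt_def fun_eq_iff)
  moreover have "diffs c n * z ^ n = (1 / 2) * (1 / fact (2 * n + 1) * z ^ n)" for n
    by (simp add: diffs_def c_def divide_simps del: of_nat_Suc) simp
  then have "(\<Sum>n. diffs c n * z ^ n) = sinhc_sqrt z / 2"
    using sums_unique[OF sums_mult[OF sinhc_sqrt_sums, of "1 / 2" z]] by simp
  ultimately show ?thesis
    by simp
qed

lemma holomorphic_sinhc_sqrt: "sinhc_sqrt holomorphic_on S"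
proof -
  have "\<exists>D. (sinhc_sqrt has_field_derivative D) (at z)" for z
    using termdiffs_strong_converges_everywhere[of "\<lambda>n. 1 / fact (2 * n + 1)" z] sinhc_sqrt_sums
    unfolding sinhc_sqrt_def[abs_def] by (auto simp: sums_iff)
  then show ?thesis
    by (auto simp: holomorphic_on_def field_differentiable_def intro: has_field_derivative_at_within)
qed

lemma holomorphic_cosh_sqrt: "cosh_sqrt holomorphic_on S"
  using has_field_derivative_cosh_sqrt
  by (auto simp: holomorphic_on_def field_differentiable_def intro: has_field_derivative_at_within)

text \<open>Differentiate \<open>s * sinhc_sqrt (s\<^sup>2) = sinh s\<close> and compare with
  \<open>cosh s\<close>.\<close>

lemma deriv_sinhc_sqrt: "2 * z * deriv sinhc_sqrt z = cosh_sqrt z - sinhc_sqrt z"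
proof (cases "z = 0")
  case False
  define s where "s = csqrt z"
  have s: "s\<^sup>2 = z" "s \<noteq> 0"
    using False by (simp_all add: s_def)
  have "(sinhc_sqrt has_field_derivative deriv sinhc_sqrt (s\<^sup>2)) (at (s\<^sup>2))"
    by (rule holomorphic_derivI[OF holomorphic_sinhc_sqrt open_UNIV UNIV_I])
  then have "((\<lambda>s. sinhc_sqrt (s\<^sup>2)) has_field_derivative deriv sinhc_sqrt (s\<^sup>2) * (2 * s)) (at s)"
    by (rule DERIV_chain2) (auto intro!: derivative_eq_intros)
  from DERIV_mult[OF DERIV_ident this]
  have "(sinh has_field_derivative sinhc_sqrt (s\<^sup>2) + deriv sinhc_sqrt (s\<^sup>2) * (2 * s) * s) (at s)"
    by (simp add: sinhc_sqrt_power2)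
  moreover have "(sinh has_field_derivative cosh s) (at s)"
    by (auto intro!: derivative_eq_intros)
  ultimately have "sinhc_sqrt (s\<^sup>2) + deriv sinhc_sqrt (s\<^sup>2) * (2 * s) * s = cosh_sqrt (s\<^sup>2)"
    by (metis DERIV_unique cosh_sqrt_power2)
  then show ?thesis
    by (simp add: power2_eq_square algebra_simps flip: s(1))
qed simp

lemma cosh_sqrt_sinhc_sqrt:
  shows cosh_sinhc_square: "(cosh_sqrt z)\<^sup>2 - z * (sinhc_sqrt z)\<^sup>2 = 1"
    and cosh_sinhc_double: "cosh_sqrt z * sinhc_sqrt z = sinhc_sqrt (4 * z)"
    and sqrt_tanh_sqrt_eq: "sqrt_tanh_sqrt z = z * sinhc_sqrt z / cosh_sqrt z"
proof -
  define s where "s = csqrt z"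
  have s: "s\<^sup>2 = z"
    by (simp add: s_def)
  have C: "cosh_sqrt z = cosh s" and T: "s * sinhc_sqrt z = sinh s"
    using cosh_sqrt_power2[of s] sinhc_sqrt_power2[of s] s by simp_all
  have "z * (sinhc_sqrt z)\<^sup>2 = (sinh s)\<^sup>2"
    by (simp add: s flip: T power_mult_distrib) (simp add: power_mult_distrib s)
  then show "(cosh_sqrt z)\<^sup>2 - z * (sinhc_sqrt z)\<^sup>2 = 1"
    by (simp add: C cosh_square_eq)
  show "cosh_sqrt z * sinhc_sqrt z = sinhc_sqrt (4 * z)"
  proof (cases "s = 0")
    case False
    have "(2 * s) * sinhc_sqrt (4 * z) = 2 * (s * sinhc_sqrt z) * cosh_sqrt z"
      using sinhc_sqrt_power2[of "2 * s"] unfolding C T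
      by (simp add: power_mult_distrib s sinh_double)
    then show ?thesis
      using False by simp
  qed (use s in simp)
  show "sqrt_tanh_sqrt z = z * sinhc_sqrt z / cosh_sqrt z"
  proof -
    have "sqrt_tanh_sqrt z = s * (s * sinhc_sqrt z) / cosh s"
      using sqrt_tanh_sqrt_power2[of s] by (simp add: s T tanh_def)
    also have "s * (s * sinhc_sqrt z) = z * sinhc_sqrt z"
      by (simp add: power2_eq_square flip: s)
    finally show ?thesis
      by (simp add: C)
  qed
qed

section \<open>Bounds on the disc from series with nonnegative coefficients\<close>

lemma norm_power_series_diff_le:
  fixes z :: complex
  assumes f: "(\<lambda>n. of_real (a n) * z ^ n) sums f" and F: "(\<lambda>n. a n * r ^ n) sums F"
    and a: "\<And>n. 0 \<le> a n" and z: "norm z \<le> r"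
  shows "norm (f - of_real (a 0)) \<le> F - a 0"
proof -
  have f': "(\<lambda>n. of_real (a (Suc n)) * z ^ Suc n) sums (f - of_real (a 0))"
    using f by (subst sums_Suc_iff) simp
  have F': "(\<lambda>n. a (Suc n) * r ^ Suc n) sums (F - a 0)"
    using F by (subst sums_Suc_iff) simp
  have "norm (\<Sum>n. of_real (a (Suc n)) * z ^ Suc n) \<le> (\<Sum>n. a (Suc n) * r ^ Suc n)"
    using a z by (intro norm_suminf_le sums_summable[OF F'])
      (auto simp: norm_mult norm_power simp del: power_Suc intro!: mult_left_mono power_mono)
  then show ?thesis
    using sums_unique[OF f'] sums_unique[OF F'] by simp
qed

lemma norm_cosh_sqrt_diff_le:
  assumes "norm z \<le> s\<^sup>2"
  shows "norm (cosh_sqrt z - 1) \<le> cosh s - 1"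
  using norm_power_series_diff_le[of "\<lambda>n. 1 / fact (2 * n)", OF _ cosh_sums_even _ assms]
    cosh_sqrt_sums[of z] by simp

lemma norm_sinhc_sqrt_diff_le:
  assumes "norm z \<le> s\<^sup>2" "s \<noteq> 0"
  shows "norm (sinhc_sqrt z - 1) \<le> sinh s / s - 1"
proof -
  have "(\<lambda>n. 1 / fact (2 * n + 1) * (s\<^sup>2) ^ n) sums (sinh s / s)"
    using sums_divide[OF sinh_sums_odd[of s], of s] assms(2) by simp
  from norm_power_series_diff_le[OF _ this _ assms(1), of "sinhc_sqrt z"] show ?thesis
    using sinhc_sqrt_sums[of z] by simp
qed

lemma cosh_1_less_2: "cosh (1::real) < 2"
proof -
  have "exp 1 + exp (-1) < 272 / 100 + (1::real)"
    by (intro add_strict_mono e_less_272) simp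
  then show ?thesis
    by (simp add: cosh_field_def)
qed

lemma sinh_1_less_2: "sinh (1::real) < 2"
proof -
  have "exp 1 - exp (-1) < 272 / 100 - (0::real)"
    by (intro diff_strict_mono e_less_272) simp
  then show ?thesis
    by (simp add: sinh_field_def)
qed

lemma sinh_2_less_4: "sinh (2::real) < 4"
proof -
  have "exp (2::real) = exp 1 * exp 1"
    by (simp flip: exp_add)
  also have "\<dots> < 272 / 100 * (272 / 100)"
    using e_less_272 by (intro mult_strict_mono) auto
  finally have "exp 2 - exp (-2) < 272 / 100 * (272 / 100) - (0::real)"
    by (intro diff_strict_mono) simp_all
  then show ?thesis
    by (simp add: sinh_field_def)
qed

text \<open>The values stay in a disc about 1 of radius less than \<open>cosh 1 - 1 < 1\<close>.
  Bounding the series at \<open>norm z\<close> instead of at 1 makes the upper bound strict.\<close>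

lemma cosh_sqrt_bounds:
  assumes "z \<in> \<D>"
  shows "0 < Re (cosh_sqrt z)" "Re (cosh_sqrt z) < cosh 1"
proof -
  have "cosh (sqrt (norm z)) < cosh 1"
    using assms by (subst cosh_real_nonneg_less_iff) auto
  moreover have "norm (cosh_sqrt z - 1) \<le> cosh (sqrt (norm z)) - 1"
    by (rule norm_cosh_sqrt_diff_le) simp
  ultimately show "0 < Re (cosh_sqrt z)" "Re (cosh_sqrt z) < cosh 1"
    using abs_Re_le_cmod[of "cosh_sqrt z - 1"] cosh_1_less_2 by auto
qed

lemma Re_sinhc_sqrt_pos:
  assumes "z \<in> \<D>"
  shows "0 < Re (sinhc_sqrt z)"
  using norm_sinhc_sqrt_diff_le[of z 1] assms abs_Re_le_cmod[of "sinhc_sqrt z - 1"] sinh_1_less_2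
  by auto

lemma cosh_sqrt_nz: "z \<in> \<D> \<Longrightarrow> cosh_sqrt z \<noteq> 0"
  using cosh_sqrt_bounds(1)[of z] by auto

lemma sinhc_sqrt_nz: "z \<in> \<D> \<Longrightarrow> sinhc_sqrt z \<noteq> 0"
  using Re_sinhc_sqrt_pos[of z] by auto

text \<open>Since \<open>sinh 2 / 2 < 2\<close>, the disc with diameter \<open>[0, sinh 2 / 2]\<close> contains the disc with
  centre \<open>1\<close> and radius \<open>sinh 2 / 2 - 1\<close>, where the values of \<open>sinhc_sqrt (4 * z)\<close> lie.\<close>

lemma Re_inverse_sinhc_sqrt:
  assumes z: "z \<in> \<D>"
  shows "1 / sinh 2 \<le> Re (1 / (2 * sinhc_sqrt (4 * z)))"
proof -
  define w where "w = sinhc_sqrt (4 * z)"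
  define a where "a = sinh (2::real) / 4"
  have a: "0 < a" "a < 1"
    using sinh_2_less_4 by (simp_all add: a_def)
  have w0: "w \<noteq> 0"
    using cosh_sqrt_nz[OF z] sinhc_sqrt_nz[OF z] by (simp add: w_def flip: cosh_sinhc_double)
  have "norm (w - 1) \<le> 2 * a - 1"
    using norm_sinhc_sqrt_diff_le[of "4 * z" 2] z by (simp add: w_def a_def norm_mult)
  moreover have "norm (w - of_real a) \<le> norm (w - 1) + norm (1 - of_real a :: complex)"
    using norm_triangle_ineq[of "w - 1" "1 - of_real a"] by simp
  moreover have "norm (1 - of_real a :: complex) = 1 - a"
    using a by (metis abs_of_pos diff_gt_0_iff_gt norm_of_real of_real_1 of_real_diff)
  ultimately have "norm (w - of_real a) \<le> a"
    by simp
  then have "norm (w - of_real a) ^ 2 \<le> a\<^sup>2"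
    by (intro power_mono) auto
  \<comment> \<open>Inversion maps a disc with 0 on its boundary to a half plane:
    \<open>|w - a| \<le> a\<close> becomes \<open>Re (1 / w) \<ge> 1 / (2 * a)\<close>, and half of
    this bound is \<open>1 / sinh 2\<close>.\<close>
  then have "norm w ^ 2 \<le> 2 * a * Re w"
    unfolding cmod_power2 by (simp add: power2_eq_square algebra_simps)
  then have "1 / (4 * a) \<le> Re w / (2 * norm w ^ 2)"
    using w0 a by (simp add: divide_simps mult_ac)
  also have "\<dots> = Re (1 / (2 * w))"
    unfolding cmod_power2 Re_divide by (simp add: power2_eq_square divide_simps)
  finally show ?thesis
    by (simp add: a_def w_def)
qed

text \<open>As \<open>sinhc_sqrt (4 * z)\<close> is \<open>sinh (2\<surd>z) / (2\<surd>z)\<close>,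
  the last formula reads \<open>1/2 + \<surd>z / sinh (2\<surd>z)\<close>. With
  \<open>C = cosh_sqrt z\<close> and \<open>T = sinhc_sqrt z\<close> it follows from
  \<open>g' = T / (2 * C)\<close>, \<open>2 * z * T' = C - T\<close> and
  \<open>C^2 - z * T^2 = 1\<close>.\<close>

lemma log_cosh_sqrt:
  obtains g where "convex_map g" "g 0 = 0"
    "\<And>z. z \<in> \<D> \<Longrightarrow> cosh_sqrt z = exp (g z)"
    "\<And>z. z \<in> \<D> \<Longrightarrow> z * deriv g z = sqrt_tanh_sqrt z / 2"
    "\<And>z. z \<in> \<D> \<Longrightarrow>
      1 + z * deriv (deriv g) z / deriv g z = 1 / 2 + 1 / (2 * sinhc_sqrt (4 * z))"
proof -
  obtain g where g: "g holomorphic_on \<D>" "g 0 = 0" "\<And>z. z \<in> \<D> \<Longrightarrow> cosh_sqrt z = exp (g z)"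
    "\<And>z. z \<in> \<D> \<Longrightarrow> deriv g z = deriv cosh_sqrt z / cosh_sqrt z"
    using disc_logarithm[of cosh_sqrt] holomorphic_cosh_sqrt cosh_sqrt_nz cosh_sqrt_0 by metis
  have g': "deriv g z = sinhc_sqrt z / (2 * cosh_sqrt z)" if "z \<in> \<D>" for z
    using g(4)[OF that] has_field_derivative_cosh_sqrt[of z] by (simp add: DERIV_imp_deriv)
  have g'': "1 + z * deriv (deriv g) z / deriv g z = 1 / 2 + 1 / (2 * sinhc_sqrt (4 * z))"
    if z: "z \<in> \<D>" for z
  proof -
    define C T T' where "C = cosh_sqrt z" and "T = sinhc_sqrt z" and "T' = deriv sinhc_sqrt z"
    have nz: "C \<noteq> 0" "T \<noteq> 0"
      using z cosh_sqrt_nz sinhc_sqrt_nz by (simp_all add: C_def T_def)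
    have "(sinhc_sqrt has_field_derivative T') (at z)"
      unfolding T'_def by (rule holomorphic_derivI[OF holomorphic_sinhc_sqrt open_UNIV UNIV_I])
    from DERIV_divide[OF this DERIV_cmult[OF has_field_derivative_cosh_sqrt, of 2]]
    have "((\<lambda>z. sinhc_sqrt z / (2 * cosh_sqrt z)) has_field_derivative
        (T' * (2 * C) - T * T) / (2 * C * (2 * C))) (at z)"
      using nz by (simp add: C_def T_def)
    then have "(deriv g has_field_derivative (T' * (2 * C) - T * T) / (2 * C * (2 * C))) (at z)"
      by (rule has_field_derivative_transform_within_open[OF _ open_ball z]) (use g' in auto)
    then have "1 + z * deriv (deriv g) z / deriv g z
        = 1 + z * ((T' * (2 * C) - T * T) / (2 * C * (2 * C))) / (T / (2 * C))"
      using g'[OF z] by (simp add: DERIV_imp_deriv C_def T_def)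
    also have "\<dots> = 1 + (2 * z * T' * C - z * T\<^sup>2) / (2 * (C * T))"
      using nz by (simp add: divide_simps) (simp add: algebra_simps power2_eq_square)
    also have "2 * z * T' = C - T"
      using deriv_sinhc_sqrt[of z] by (simp add: C_def T_def T'_def)
    also have "z * T\<^sup>2 = C\<^sup>2 - 1"
      using cosh_sinhc_square[of z] by (simp add: C_def T_def algebra_simps)
    also have "1 + ((C - T) * C - (C\<^sup>2 - 1)) / (2 * (C * T)) = 1 / 2 + 1 / (2 * (C * T))"
      using nz by (simp add: field_simps power2_eq_square)
    finally show ?thesis
      by (simp add: C_def T_def cosh_sinhc_double)
  qed
  have "convex_map g"
  proof
    fix z :: complex
    assume z: "z \<in> \<D>"
    show "deriv g z \<noteq> 0"
      using g'[OF z] cosh_sqrt_nz[OF z] sinhc_sqrt_nz[OF z] by simp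
    have "0 < 1 / sinh (2::real)"
      by simp
    also note Re_inverse_sinhc_sqrt[OF z]
    finally have "0 < Re (1 / 2 + 1 / (2 * sinhc_sqrt (4 * z)))"
      by simp
    then show "0 < Re (1 + z * deriv (deriv g) z / deriv g z)"
      unfolding g''[OF z] .
  qed (fact g(1))
  then show ?thesis
    using that[OF _ g(2,3) _ g''] g' by (simp add: sqrt_tanh_sqrt_eq)
qed

section \<open>Univalence, dominance and optimality of \<open>cosh_sqrt\<close>\<close>

lemma univalent_cosh_sqrt: "univalent cosh_sqrt"
  unfolding univalent_def
proof
  show "inj_on cosh_sqrt \<D>"
  proof (rule inj_onI, rule ccontr)
    fix a b
    assume ab: "a \<in> \<D>" "b \<in> \<D>" "cosh_sqrt a = cosh_sqrt b" "a \<noteq> b"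
    \<comment> \<open>The derivative \<open>sinhc_sqrt z / 2\<close> has positive real part on the
      convex disc.\<close>
    have "0 < Re ((cosh_sqrt b - cosh_sqrt a) / (b - a))"
      using Re_sinhc_sqrt_pos
      by (intro Re_difference_quotient_pos[OF convex_ball ab(1,2,4) has_field_derivative_cosh_sqrt]) simp
    with ab show False
      by simp
  qed
qed (rule holomorphic_cosh_sqrt)

lemma subordinate_cosh_sqrt:
  assumes \<eta>: "\<eta> \<ge> eta0" and p: "p holomorphic_on \<D>" "\<forall>z\<in>\<D>. p z \<noteq> 0" "p 0 = 1"
    and sub: "diff_subordination \<eta> p"
  shows "p \<prec> cosh_sqrt"
proof -
  obtain g where g: "convex_map g" "g 0 = 0"
    "\<And>z. z \<in> \<D> \<Longrightarrow> cosh_sqrt z = exp (g z)"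
    "\<And>z. z \<in> \<D> \<Longrightarrow> z * deriv g z = sqrt_tanh_sqrt z / 2"
    "\<And>z. z \<in> \<D> \<Longrightarrow>
      1 + z * deriv (deriv g) z / deriv g z = 1 / 2 + 1 / (2 * sinhc_sqrt (4 * z))"
    using log_cosh_sqrt by blast
  obtain P where P: "P holomorphic_on \<D>" "P 0 = 0" "\<And>z. z \<in> \<D> \<Longrightarrow> p z = exp (P z)"
    "\<And>z. z \<in> \<D> \<Longrightarrow> deriv P z = deriv p z / p z"
    using disc_logarithm[of p] p by blast
  obtain w where w: "w holomorphic_on \<D>" "w ` \<D> \<subseteq> \<D>" "w 0 = 0"
    "\<And>z. z \<in> \<D> \<Longrightarrow> of_real \<eta> * p z + z * deriv p z / p z
      = of_real \<eta> * cosh_sqrt (w z) + sqrt_tanh_sqrt (w z) / 2"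
    using sub unfolding diff_subordination_def subordinate_def by blast
  define \<theta> :: "complex \<Rightarrow> complex" where "\<theta> = (\<lambda>u. of_real \<eta> * exp u)"
  have \<theta>': "deriv \<theta> u = of_real \<eta> * exp u" for u
    unfolding \<theta>_def by (rule DERIV_imp_deriv) (auto intro!: derivative_eq_intros)
  have "P \<prec> g"
  proof (rule convex_map.subordination[OF g(1) _ _ P(1) _ w(1,2,3)])
    show "\<theta> holomorphic_on UNIV"
      unfolding \<theta>_def by (intro holomorphic_intros)
    show "P 0 = g 0"
      by (simp add: P(2) g(2))
    fix z assume z: "z \<in> \<D>"
    have wz: "w z \<in> \<D>"
      using w(2) z by blast
    show "\<theta> (P z) + z * deriv P z = \<theta> (g (w z)) + w z * deriv g (w z)"
      using w(4)[OF z] P(3,4)[OF z] g(3,4)[OF wz] by (simp add: \<theta>_def)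
    show "0 < Re (deriv \<theta> (g z) + (1 + z * deriv (deriv g) z / deriv g z))"
    proof -
      \<comment> \<open>\<open>c\<close> bounds \<open>Re (1 + z g'' / g')\<close> from below, and
        \<open>eta0\<close> is the number with \<open>eta0 * cosh 1 = - c\<close>. As
        \<open>eta0 < 0\<close>, the bound \<open>Re (cosh_sqrt z) < cosh 1\<close> gives the strict
        inequality; positivity of \<open>Re (cosh_sqrt z)\<close> then allows passing from
        \<open>eta0\<close> to \<open>\<eta>\<close>.\<close>
      define c where "c = 1 / 2 + 1 / sinh (2::real)"
      have c: "0 < c"
        unfolding c_def by (intro add_pos_pos) auto
      have "- c = eta0 * cosh 1"
        by (simp add: eta0_def c_def)
      also have "\<dots> < eta0 * Re (cosh_sqrt z)"
        using c cosh_sqrt_bounds(2)[OF z]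
        by (intro mult_strict_left_mono_neg) (auto simp: eta0_def c_def[symmetric] mult_neg_pos)
      also have "\<dots> \<le> \<eta> * Re (cosh_sqrt z)"
        using \<eta> cosh_sqrt_bounds(1)[OF z] by (intro mult_right_mono) auto
      also have "\<dots> = Re (deriv \<theta> (g z))"
        by (simp add: \<theta>' g(3)[OF z])
      finally have "- c < Re (deriv \<theta> (g z))" .
      moreover have "c \<le> Re (1 / 2 + 1 / (2 * sinhc_sqrt (4 * z)))"
        using Re_inverse_sinhc_sqrt[OF z] unfolding plus_complex.sel c_def by simp
      ultimately show ?thesis
        unfolding g(5)[OF z] by simp
    qed
  qed
  then obtain \<omega> where \<omega>: "\<omega> holomorphic_on \<D>" "\<omega> ` \<D> \<subseteq> \<D>" "\<omega> 0 = 0" "\<And>z. z \<in> \<D> \<Longrightarrow> P z = g (\<omega> z)"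
    unfolding subordinate_def by blast
  have "p z = cosh_sqrt (\<omega> z)" if z: "z \<in> \<D>" for z
    using P(3)[OF z] \<omega>(4)[OF z] g(3)[OF subsetD[OF \<omega>(2) imageI[OF z]]] by simp
  then show ?thesis
    unfolding subordinate_def using p(1) holomorphic_cosh_sqrt \<omega> by blast
qed

text \<open>The identity serves as inner map. Thus \<open>cosh_sqrt\<close> is itself one of the
  functions that every dominant has to dominate, which makes it the best one.\<close>

lemma diff_subordination_cosh_sqrt: "diff_subordination \<eta> cosh_sqrt"
proof -
  have eq: "of_real \<eta> * cosh_sqrt z + z * deriv cosh_sqrt z / cosh_sqrt z
      = of_real \<eta> * cosh_sqrt z + sqrt_tanh_sqrt z / 2" for z
    using has_field_derivative_cosh_sqrt[of z] by (simp add: sqrt_tanh_sqrt_eq DERIV_imp_deriv)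
  have "(\<lambda>z. of_real \<eta> * cosh_sqrt z + sqrt_tanh_sqrt z / 2) holomorphic_on \<D>"
    unfolding sqrt_tanh_sqrt_eq
    by (intro holomorphic_intros holomorphic_cosh_sqrt holomorphic_sinhc_sqrt cosh_sqrt_nz) auto
  then show ?thesis
    unfolding diff_subordination_def subordinate_def eq
    by (auto intro!: exI[of _ "\<lambda>z. z"] holomorphic_intros)
qed

theorem theorem3p7:
  fixes \<eta> :: real and p :: "complex \<Rightarrow> complex"
  assumes "\<eta> \<ge> eta0"
    and "p holomorphic_on \<D>"
    and "\<forall>z\<in>\<D>. p z \<noteq> 0"
    and "p 0 = 1"
    and "diff_subordination \<eta> p"
  shows "p \<prec> cosh_sqrt \<and>
    best_dominant
      {f. f holomorphic_on \<D> \<and> (\<forall>z\<in>\<D>. f z \<noteq> 0) \<and> f 0 = 1 \<and> diff_subordination \<eta> f}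
      cosh_sqrt"
  unfolding best_dominant_def dominant_def
  using subordinate_cosh_sqrt[OF assms(1)] assms(2-) univalent_cosh_sqrt holomorphic_cosh_sqrt
    cosh_sqrt_nz cosh_sqrt_0 diff_subordination_cosh_sqrt
  by blast

end
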